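(* Let $p\colon[0,1]\to[1,\infty)$ be measurable and let $f\in L^{p(\cdot)}$ (the ODE-determined class). Then $$|||f|||_{p(\cdot)}\le\|f\|_{p(\cdot)}\le 2\,|||f|||_{p(\cdot)}.$$
   Context: $L^0$ is the space of Lebesgue measurable functions $[0,1]\to\mathbb{R}$. The Nakano norm is $$|||g|||_{p(\cdot)}:=\inf\left\{\lambda>0\colon\int_0^1\frac{1}{p(t)}\left(\frac{|g(t)|}{\lambda}\right)^{p(t)}dt\le1\right\}.$$ ODE-determined class: for $f\in L^0$ and $x_0>0$, a solution with initial value $x_0$ (weak, in the sense of Carathéodory) is an absolutely continuous function $\varphi_{f,x_0}\colon[0,1]\to(0,\infty)$ with $\varphi_{f,x_0}(T)=x_0+\int_0^T \frac{|f(t)|^{p(t)}}{p(t)}\varphi_{f,x_0}(t)^{1-p(t)}\,dt$ for all $T\in[0,1]$; it is unique if it exists. If it exists for every $x_0>0$, then as $x_0\searrow0$ the functions $\varphi_{f,x_0}$ decrease to an absolutely continuous function $\varphi_f$ which solves $\varphi'(t)=\frac{|f(t)|^{p(t)}}{p(t)}\varphi(t)^{1-p(t)}$ for a.e. $t$, with $\varphi(0)=0$ (the right-hand side is read as $0$ where $f(t)=0$); this is called the solution with initial value $0^+$. The class $L^{p(\cdot)}\subset L^0$ consists of those $f$ for which $\varphi_f$ exists, i.e. for which $\varphi_{f,x_0}$ exists on $[0,1]$ for every $x_0>0$. For $f\in L^{p(\cdot)}$ put $\|f\|_{p(\cdot)}:=\varphi_f(1)$; this notation is used even when $L^{p(\cdot)}$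 is not a linear space. *)

theory Defs
  imports "HOL-Analysis.Analysis"
begin

text \<open>
  Functions on \<open>[0,1]\<close> are represented by total functions \<open>real \<Rightarrow> real\<close>; only their values
  on \<open>{0..1}\<close> matter below.
\<close>

definition L0 :: "(real \<Rightarrow> real) set" where
  "L0 = borel_measurable (lebesgue_on {0..1})"

text \<open>The infimum is taken in the extended reals, so that the infimum of the empty set is \<open>\<infinity>\<close>.\<close>

definition nakano_norm :: "(real \<Rightarrow> real) \<Rightarrow> (real \<Rightarrow> real) \<Rightarrow> ereal" where
  "nakano_norm p g =
     Inf {ereal l | l. 0 < l \<and>
        (\<integral>\<^sup>+ t. ennreal (1 / p t * (\<bar>g t\<bar> / l) powr p t) \<partial>lebesgue_on {0..1}) \<le> 1}"

definition abs_continuous_on :: "real \<Rightarrow> real \<Rightarrow> (real \<Rightarrow> real) \<Rightarrow> bool" where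
  "abs_continuous_on a b \<phi> \<longleftrightarrow>
     (\<forall>\<epsilon>>0. \<exists>\<delta>>0. \<forall>(I :: nat set) u v.
        finite I \<longrightarrow> (\<forall>i\<in>I. a \<le> u i \<and> u i \<le> v i \<and> v i \<le> b) \<longrightarrow>
        disjoint_family_on (\<lambda>i. {u i<..<v i}) I \<longrightarrow>
        (\<Sum>i\<in>I. v i - u i) < \<delta> \<longrightarrow> (\<Sum>i\<in>I. \<bar>\<phi> (v i) - \<phi> (u i)\<bar>) < \<epsilon>)"

definition ode_rhs :: "(real \<Rightarrow> real) \<Rightarrow> (real \<Rightarrow> real) \<Rightarrow> (real \<Rightarrow> real) \<Rightarrow> real \<Rightarrow> real" where
  "ode_rhs p f \<phi> t = \<bar>f t\<bar> powr p t / p t * \<phi> t powr (1 - p t)"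

text \<open>
  Integrability is required separately because the Bochner integral of a non-integrable
  function is \<open>0\<close>.
\<close>

definition is_ode_solution ::
    "(real \<Rightarrow> real) \<Rightarrow> (real \<Rightarrow> real) \<Rightarrow> real \<Rightarrow> (real \<Rightarrow> real) \<Rightarrow> bool" where
  "is_ode_solution p f x0 \<phi> \<longleftrightarrow>
     abs_continuous_on 0 1 \<phi> \<and> (\<forall>t\<in>{0..1}. 0 < \<phi> t) \<and>
     integrable (lebesgue_on {0..1}) (ode_rhs p f \<phi>) \<and>
     (\<forall>T\<in>{0..1}. \<phi> T = x0 + (\<integral>t. ode_rhs p f \<phi> t \<partial>lebesgue_on {0..T}))"

definition ode_class :: "(real \<Rightarrow> real) \<Rightarrow> (real \<Rightarrow> real) set" where
  "ode_class p = {f \<in> L0. \<forall>x0>0. \<exists>\<phi>. is_ode_solution p f x0 \<phi>}"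

text \<open>
  Solutions are unique on \<open>{0..1}\<close> but arbitrary outside of it, hence the choice operator
  instead of a definite description. For \<open>f \<in> ode_class p\<close> the solution is nondecreasing in its
  initial value, so the one-sided limit defining the solution with initial value \<open>0\<^sup>+\<close> exists
  at every point of \<open>{0..1}\<close>.
\<close>

definition ode_solution :: "(real \<Rightarrow> real) \<Rightarrow> (real \<Rightarrow> real) \<Rightarrow> real \<Rightarrow> real \<Rightarrow> real" where
  "ode_solution p f x0 = (SOME \<phi>. is_ode_solution p f x0 \<phi>)"

definition ode_solution_zero :: "(real \<Rightarrow> real) \<Rightarrow> (real \<Rightarrow> real) \<Rightarrow> real \<Rightarrow> real" where
  "ode_solution_zero p f t = Lim (at_right 0) (\<lambda>x0. ode_solution p f x0 t)"

definition ode_norm :: "(real \<Rightarrow> real) \<Rightarrow> (real \<Rightarrow> real) \<Rightarrow> real" where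
  "ode_norm p f = ode_solution_zero p f 1"

end

theory Submission
  imports Defs
begin

text \<open>
  Both bounds come from the monotonicity of \<open>\<phi> \<mapsto> \<phi> powr (1 - p)\<close>. A solution \<open>\<phi>\<close> is at
  most \<open>M = \<phi> 1\<close>, so its right-hand side is at least \<open>M\<close> times the modular of \<open>f / M\<close>, and
  hence that modular is at most \<open>1\<close>. Conversely, if the modular of \<open>f / l\<close> is at most \<open>1\<close>, then
  from the time at which \<open>\<phi>\<close> reaches \<open>l\<close> its right-hand side is at most \<open>l\<close> times the integrand
  of that modular, so \<open>\<phi>\<close> grows by at most \<open>l\<close> more.
\<close>

text \<open>A family consisting of one interval already gives uniform continuity.\<close>

lemma abs_continuous_on_imp_continuous_on:
  assumes "abs_continuous_on a b \<phi>"
  shows "continuous_on {a..b} \<phi>"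
  unfolding continuous_on_iff
proof (intro ballI allI impI)
  fix x e :: real assume x: "x \<in> {a..b}" and e: "0 < e"
  from assms[unfolded abs_continuous_on_def, rule_format, OF e]
  obtain d where d: "d > 0" and D: "\<forall>(I :: nat set) u v. finite I \<longrightarrow>
      (\<forall>i\<in>I. a \<le> u i \<and> u i \<le> v i \<and> v i \<le> b) \<longrightarrow>
      disjoint_family_on (\<lambda>i. {u i<..<v i}) I \<longrightarrow>
      (\<Sum>i\<in>I. v i - u i) < d \<longrightarrow> (\<Sum>i\<in>I. \<bar>\<phi> (v i) - \<phi> (u i)\<bar>) < e"
    by (elim exE conjE)
  have D': "\<bar>\<phi> s - \<phi> r\<bar> < e" if "a \<le> r" "r \<le> s" "s \<le> b" "s - r < d" for r s
    using D[THEN spec, of "{0}", THEN spec, of "\<lambda>_. r", THEN spec, of "\<lambda>_. s"] that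
    by (simp add: disjoint_family_on_def)
  show "\<exists>d>0. \<forall>x'\<in>{a..b}. dist x' x < d \<longrightarrow> dist (\<phi> x') (\<phi> x) < e"
  proof (intro exI[of _ d] conjI ballI impI d)
    fix y assume y: "y \<in> {a..b}" "dist y x < d"
    show "dist (\<phi> y) (\<phi> x) < e"
    proof (cases "x \<le> y")
      case True
      then show ?thesis using D'[of x y] x y by (auto simp: dist_real_def)
    next
      case False
      then show ?thesis using D'[of y x] x y by (auto simp: dist_real_def abs_minus_commute)
    qed
  qed
qed

lemma ode_solution_continuous_on:
  "is_ode_solution p f x \<phi> \<Longrightarrow> continuous_on {0..1} \<phi>"
  by (simp add: is_ode_solution_def abs_continuous_on_imp_continuous_on)

lemma ode_solution_pos:
  "is_ode_solution p f x \<phi> \<Longrightarrow> t \<in> {0..1} \<Longrightarrow> 0 < \<phi> t"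
  unfolding is_ode_solution_def by blast

lemma ode_rhs_nonneg: "1 \<le> p t \<Longrightarrow> 0 \<le> ode_rhs p f \<phi> t"
  by (simp add: ode_rhs_def)

lemma ode_rhs_antimono:
  assumes "1 \<le> p t" "0 < \<phi> t" "\<phi> t \<le> \<psi> t"
  shows "ode_rhs p f \<psi> t \<le> ode_rhs p f \<phi> t"
proof -
  have "\<psi> t powr (1 - p t) \<le> \<phi> t powr (1 - p t)"
    using assms by (intro powr_mono2') auto
  then show ?thesis
    unfolding ode_rhs_def using assms by (intro mult_left_mono) auto
qed

text \<open>The link between the equation and the Nakano modular: since
  \<open>l powr (1 - p t) = l * l powr (- p t)\<close>, freezing the solution at the level
  \<open>l\<close> turns the right-hand side into \<open>l\<close> times the modular's
  integrand.\<close>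

lemma ode_rhs_const:
  assumes "0 < l"
  shows "ode_rhs p f (\<lambda>_. l) t = l * (1 / p t * (\<bar>f t\<bar> / l) powr p t)"
  using assms by (simp add: ode_rhs_def powr_divide powr_diff)

lemma ode_solution_0:
  assumes "is_ode_solution p f x \<phi>"
  shows "\<phi> 0 = x"
  \<comment> \<open>At \<open>T = 0\<close> the integral runs over the null set
    \<open>{0..0}\<close>.\<close>
  using assms integral_eq_zero_null_sets[of "{0..0}" "ode_rhs p f \<phi>"]
  by (simp add: is_ode_solution_def)

lemma ode_rhs_integrable_on:
  assumes "is_ode_solution p f x \<phi>" "0 \<le> S" "T \<le> 1"
  shows "integrable (lebesgue_on {S..T}) (ode_rhs p f \<phi>)"
  using assms
  by (auto simp: is_ode_solution_def intro!: integrable_subinterval[of 0 1])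

text \<open>Subtract the integral equations at \<open>S\<close> and \<open>T\<close>. Additivity
  over adjacent intervals comes from the gauge integral, which agrees with the Lebesgue integral on
  integrable functions.\<close>

lemma ode_solution_diff:
  assumes "is_ode_solution p f x \<phi>" "0 \<le> S" "S \<le> T" "T \<le> 1"
  shows "\<phi> T - \<phi> S = integral\<^sup>L (lebesgue_on {S..T}) (ode_rhs p f \<phi>)"
proof -
  let ?g = "ode_rhs p f \<phi>"
  have hk: "integral\<^sup>L (lebesgue_on {s..t}) ?g = integral {s..t} ?g" if "0 \<le> s" "t \<le> 1" for s t
    by (rule lebesgue_integral_eq_integral) (use ode_rhs_integrable_on[OF assms(1) that] in auto)
  have "?g integrable_on {0..T}"
    by (rule integrable_on_lebesgue_on) (use ode_rhs_integrable_on[OF assms(1), of 0 T] assms in auto)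
  then have "integral {0..S} ?g + integral {S..T} ?g = integral {0..T} ?g"
    using assms by (intro Henstock_Kurzweil_Integration.integral_combine) auto
  moreover have "\<phi> t = x + integral {0..t} ?g" if "t \<in> {0..1}" for t
    using assms(1) hk[of 0 t] that by (auto simp: is_ode_solution_def)
  ultimately show ?thesis
    using assms hk[of S T] by auto
qed

lemma ode_solution_mono_time:
  assumes "is_ode_solution p f x \<phi>" "\<forall>t\<in>{0..1}. 1 \<le> p t" "0 \<le> S" "S \<le> T" "T \<le> 1"
  shows "\<phi> S \<le> \<phi> T"
proof -
  have "0 \<le> integral\<^sup>L (lebesgue_on {S..T}) (ode_rhs p f \<phi>)"
    using assms by (intro Bochner_Integration.integral_nonneg) (auto intro!: ode_rhs_nonneg)
  then show ?thesis
    using ode_solution_diff[OF assms(1,3-5)] by simp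
qed

text \<open>After the last time at which \<open>\<phi>\<close> is not above \<open>\<psi>\<close>,
  the larger function has the smaller right-hand side, so \<open>\<phi>\<close> cannot outgrow
  \<open>\<psi>\<close>. For \<open>x = y\<close> this also yields uniqueness.\<close>

lemma ode_solution_mono_initial:
  assumes sol: "is_ode_solution p f x \<phi>" "is_ode_solution p f y \<psi>"
    and p: "\<forall>t\<in>{0..1}. 1 \<le> p t" and "x \<le> y" and T: "T \<in> {0..1}"
  shows "\<phi> T \<le> \<psi> T"
proof (rule ccontr)
  assume neg: "\<not> \<phi> T \<le> \<psi> T"
  define A where "A = {t \<in> {0..T}. \<phi> t \<le> \<psi> t}"
  have cont: "continuous_on {0..T} \<phi>" "continuous_on {0..T} \<psi>"
    using sol[THEN ode_solution_continuous_on] T by (auto elim: continuous_on_subset)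
  \<comment> \<open>Compactness makes the last time \<open>S\<close> in \<open>A\<close>
    exist.\<close>
  have "compact A"
    unfolding A_def compact_eq_bounded_closed using cont
    by (intro conjI continuous_on_closed_Collect_le bounded_subset[OF bounded_closed_interval[of 0 T]]) auto
  moreover have "0 \<in> A"
    using sol[THEN ode_solution_0] T \<open>x \<le> y\<close> by (auto simp: A_def)
  ultimately obtain S where S: "S \<in> A" "\<And>t. t \<in> A \<Longrightarrow> t \<le> S"
    using compact_attains_sup[of A] by blast
  have ST: "0 \<le> S" "S \<le> T" "\<phi> S \<le> \<psi> S"
    using S(1) by (auto simp: A_def)
  \<comment> \<open>Otherwise \<open>\<phi> - \<psi>\<close> is negative at \<open>t\<close> and
    positive at \<open>T\<close>, and its zero in between is a member of \<open>A\<close> later than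
    \<open>S\<close>.\<close>
  have above: "\<psi> t \<le> \<phi> t" if t: "t \<in> {S..T}" for t
  proof (rule ccontr)
    assume "\<not> \<psi> t \<le> \<phi> t"
    moreover have "continuous_on {t..T} (\<lambda>t. \<phi> t - \<psi> t)"
      using cont t ST by (intro continuous_on_diff) (auto elim: continuous_on_subset)
    ultimately obtain s where "t \<le> s" "s \<le> T" "\<phi> s - \<psi> s = 0"
      using IVT'[of "\<lambda>t. \<phi> t - \<psi> t" t 0 T] neg t by force
    moreover from this have "s \<noteq> t" using \<open>\<not> \<psi> t \<le> \<phi> t\<close> by auto
    ultimately show False
      using S(2)[of s] t ST by (auto simp: A_def)
  qed
  have "integral\<^sup>L (lebesgue_on {S..T}) (ode_rhs p f \<phi>)
      \<le> integral\<^sup>L (lebesgue_on {S..T}) (ode_rhs p f \<psi>)"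
  proof (rule integral_mono)
    show "integrable (lebesgue_on {S..T}) (ode_rhs p f \<phi>)"
      "integrable (lebesgue_on {S..T}) (ode_rhs p f \<psi>)"
      using sol[THEN ode_rhs_integrable_on] ST T by auto
    show "ode_rhs p f \<phi> t \<le> ode_rhs p f \<psi> t" if "t \<in> space (lebesgue_on {S..T})" for t
      using that ST T p above by (intro ode_rhs_antimono ode_solution_pos[OF sol(2)]) auto
  qed
  then show False
    using ode_solution_diff[OF sol(1), of S T] ode_solution_diff[OF sol(2), of S T] ST T neg by auto
qed

text \<open>Expresses the growth of \<open>\<phi>\<close> in units of \<open>l\<close> as a
  nonnegative integral, so that it can be compared pointwise with the modular without showing the
  modular's integrand integrable.\<close>

lemma nn_integral_ode_rhs:
  assumes "is_ode_solution p f x \<phi>" "\<forall>t\<in>{0..1}. 1 \<le> p t" "0 \<le> S" "S \<le> T" "T \<le> 1" "0 < l"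
  shows "(\<integral>\<^sup>+ t. ennreal (ode_rhs p f \<phi> t / l) \<partial>lebesgue_on {S..T}) = ennreal ((\<phi> T - \<phi> S) / l)"
proof -
  have "(\<integral>\<^sup>+ t. ennreal (ode_rhs p f \<phi> t / l) \<partial>lebesgue_on {S..T})
      = ennreal (\<integral>t. ode_rhs p f \<phi> t / l \<partial>lebesgue_on {S..T})"
    using assms ode_rhs_integrable_on[OF assms(1,3,5)]
    by (intro nn_integral_eq_integral) (auto intro!: divide_nonneg_pos ode_rhs_nonneg)
  then show ?thesis
    using ode_solution_diff[OF assms(1,3-5)] by simp
qed

lemma modular_ode_solution_le_1:
  assumes sol: "is_ode_solution p f x \<phi>" and p: "\<forall>t\<in>{0..1}. 1 \<le> p t" and "0 \<le> x"
  shows "(\<integral>\<^sup>+ t. ennreal (1 / p t * (\<bar>f t\<bar> / \<phi> 1) powr p t) \<partial>lebesgue_on {0..1}) \<le> 1"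
proof -
  have pos: "0 < \<phi> 1" using ode_solution_pos[OF sol] by simp
  have "(\<integral>\<^sup>+ t. ennreal (1 / p t * (\<bar>f t\<bar> / \<phi> 1) powr p t) \<partial>lebesgue_on {0..1})
      \<le> (\<integral>\<^sup>+ t. ennreal (ode_rhs p f \<phi> t / \<phi> 1) \<partial>lebesgue_on {0..1})"
  proof (intro nn_integral_mono ennreal_leI)
    fix t assume "t \<in> space (lebesgue_on {0..1::real})"
    then have t: "t \<in> {0..1}" by simp
    have "ode_rhs p f (\<lambda>_. \<phi> 1) t \<le> ode_rhs p f \<phi> t"
      using t p ode_solution_mono_time[OF sol p, of t 1]
      by (intro ode_rhs_antimono ode_solution_pos[OF sol]) auto
    then show "1 / p t * (\<bar>f t\<bar> / \<phi> 1) powr p t \<le> ode_rhs p f \<phi> t / \<phi> 1"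
      using ode_rhs_const[OF pos, of p f t] pos by (simp add: field_simps)
  qed
  also have "\<dots> = ennreal ((\<phi> 1 - \<phi> 0) / \<phi> 1)"
    using nn_integral_ode_rhs[OF sol p, of 0 1] pos by simp
  also have "\<dots> \<le> ennreal 1"
    using pos ode_solution_0[OF sol] \<open>0 \<le> x\<close> by (intro ennreal_leI) (simp add: field_simps)
  finally show ?thesis by simp
qed

lemma ode_solution_le_twice:
  assumes sol: "is_ode_solution p f x \<phi>" and p: "\<forall>t\<in>{0..1}. 1 \<le> p t"
    and "0 < l" "x \<le> l"
    and modular: "(\<integral>\<^sup>+ t. ennreal (1 / p t * (\<bar>f t\<bar> / l) powr p t) \<partial>lebesgue_on {0..1}) \<le> 1"
  shows "\<phi> 1 \<le> 2 * l"
proof (cases "l \<le> \<phi> 1")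
  case True
  \<comment> \<open>The crossing time exists because \<open>\<phi>\<close> starts at
    \<open>x \<le> l\<close>; this restriction is harmless, as \<open>x\<close> will tend to
    0.\<close>
  then obtain T where T: "0 \<le> T" "T \<le> 1" "\<phi> T = l"
    using IVT'[of \<phi> 0 l 1] ode_solution_0[OF sol] ode_solution_continuous_on[OF sol] \<open>x \<le> l\<close>
    by auto
  have "ennreal ((\<phi> 1 - \<phi> T) / l) = (\<integral>\<^sup>+ t. ennreal (ode_rhs p f \<phi> t / l) \<partial>lebesgue_on {T..1})"
    using nn_integral_ode_rhs[OF sol p, of T 1] T \<open>0 < l\<close> by simp
  also have "\<dots> \<le> (\<integral>\<^sup>+ t. ennreal (1 / p t * (\<bar>f t\<bar> / l) powr p t) \<partial>lebesgue_on {T..1})"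
  proof (intro nn_integral_mono ennreal_leI)
    fix t assume "t \<in> space (lebesgue_on {T..1})"
    then have t: "T \<le> t" "t \<le> 1" by auto
    \<comment> \<open>From \<open>T\<close> on, \<open>\<phi>\<close> stays at or above
      \<open>l\<close>, so freezing it at \<open>l\<close> can only raise the right-hand
      side.\<close>
    have "ode_rhs p f \<phi> t \<le> ode_rhs p f (\<lambda>_. l) t"
      using t T p \<open>0 < l\<close> ode_solution_mono_time[OF sol p, of T t]
      by (intro ode_rhs_antimono) auto
    then show "ode_rhs p f \<phi> t / l \<le> 1 / p t * (\<bar>f t\<bar> / l) powr p t"
      using ode_rhs_const[OF \<open>0 < l\<close>, of p f t] \<open>0 < l\<close> by (simp add: field_simps)
  qed
  also have "\<dots> \<le> (\<integral>\<^sup>+ t. ennreal (1 / p t * (\<bar>f t\<bar> / l) powr p t) \<partial>lebesgue_on {0..1})"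
    using T by (auto simp: nn_integral_restrict_space indicator_def intro!: nn_integral_mono)
  also have "\<dots> \<le> ennreal 1" using modular by simp
  finally show ?thesis
    using T \<open>0 < l\<close> by (simp add: field_simps)
qed (use \<open>0 < l\<close> in simp)

text \<open>\<open>Lim\<close> alone does not guarantee convergence. Here the values at time 1 are
  nondecreasing in \<open>x\<close> and bounded below by 0, so the right limit at 0 exists and
  equals their infimum.\<close>

lemma ode_solution_tendsto_ode_norm:
  assumes p: "\<forall>t\<in>{0..1}. 1 \<le> p t"
    and sol: "\<And>x. 0 < x \<Longrightarrow> is_ode_solution p f x (ode_solution p f x)"
  shows "((\<lambda>x. ode_solution p f x 1) \<longlongrightarrow> ode_norm p f) (at_right 0)"
proof -
  have "((\<lambda>x. ode_solution p f x 1) \<longlongrightarrow>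
      Inf ((\<lambda>x. ode_solution p f x 1) ` ({0<..} \<inter> UNIV))) (at 0 within ({0<..} \<inter> UNIV))"
  proof (rule Lim_right_bound)
    show "ode_solution p f x 1 \<le> ode_solution p f y 1" if "0 < x" "x \<le> y" for x y
      using that by (intro ode_solution_mono_initial[OF sol sol p]) auto
    show "0 \<le> ode_solution p f x 1" if "0 < x" for x
      using ode_solution_pos[OF sol[OF that], of 1] by simp
  qed
  then show ?thesis
    unfolding ode_norm_def ode_solution_zero_def by (simp add: tendsto_Lim)
qed

theorem proposition3p3:
  fixes p f :: "real \<Rightarrow> real"
  assumes "p \<in> borel_measurable (lebesgue_on {0..1})"
    and "\<forall>t\<in>{0..1}. 1 \<le> p t"
    and "f \<in> ode_class p"
  shows "nakano_norm p f \<le> ereal (ode_norm p f) \<and>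
         ereal (ode_norm p f) \<le> 2 * nakano_norm p f"
proof
  note p = assms(2)
  have sol: "is_ode_solution p f x (ode_solution p f x)" if "0 < x" for x
    using assms(3) that unfolding ode_class_def ode_solution_def by (auto intro!: someI_ex[of "is_ode_solution p f x"])
  have lim: "((\<lambda>x. ode_solution p f x 1) \<longlongrightarrow> ode_norm p f) (at_right 0)"
    by (rule ode_solution_tendsto_ode_norm[OF p sol])
  \<comment> \<open>The final value of every solution is itself an admissible \<open>l\<close> in
    the Nakano infimum; the bound then passes to the limit.\<close>
  have "nakano_norm p f \<le> ereal (ode_solution p f x 1)" if "0 < x" for x
    unfolding nakano_norm_def
    using ode_solution_pos[OF sol[OF that], of 1] modular_ode_solution_le_1[OF sol[OF that] p] that
    by (intro Inf_lower) auto
  then show "nakano_norm p f \<le> ereal (ode_norm p f)"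
    using lim by (intro tendsto_lowerbound[of "\<lambda>x. ereal (ode_solution p f x 1)" _ "at_right 0"])
      (auto simp: eventually_at_filter)
  \<comment> \<open>Halving makes the claim a lower bound for each admissible \<open>l\<close>,
    which also covers an empty set of such \<open>l\<close>, with infimum \<infinity>.\<close>
  have "ereal (ode_norm p f / 2) \<le> nakano_norm p f"
    unfolding nakano_norm_def
  proof (rule Inf_greatest, clarify)
    fix l :: real
    assume l: "0 < l"
      "(\<integral>\<^sup>+ t. ennreal (1 / p t * (\<bar>f t\<bar> / l) powr p t) \<partial>lebesgue_on {0..1}) \<le> 1"
    \<comment> \<open>The bound holds for all \<open>x\<close> in \<open>{0<..<l}\<close>.\<close>
    have "eventually (\<lambda>x. ode_solution p f x 1 \<le> 2 * l) (at_right 0)"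
      using eventually_at_right_real[OF l(1)]
      by eventually_elim (use l in \<open>auto intro: ode_solution_le_twice[OF sol p]\<close>)
    then have "ode_norm p f \<le> 2 * l"
      using lim by (intro tendsto_upperbound) auto
    then show "ereal (ode_norm p f / 2) \<le> ereal l" by simp
  qed
  then have "2 * ereal (ode_norm p f / 2) \<le> 2 * nakano_norm p f"
    by (rule ereal_mult_left_mono) simp
  then show "ereal (ode_norm p f) \<le> 2 * nakano_norm p f" by simp
qed

end
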